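(* Let $m\ge1$ and let $\{A(k)\}_{k\ge0}$ be a chain of $m\times m$ doubly stochastic matrices with a permutation component $\{P(k)\}$. Then, for any starting time $t_0\ge0$, the product $A(k:t_0)$ converges up to a permutation of its rows; i.e., there exists a sequence $\{Q(k)\}$ of $m\times m$ permutation matrices such that $\lim_{k\to\infty}Q(k)A(k:t_0)$ exists for any $t_0\ge0$. Moreover, for $i,j\in[m]$ and the trajectories $\{i(k)\}$ and $\{j(k)\}$ of $S(0)=\{i\}$ and $S(0)=\{j\}$, respectively, under $\{P(k)\}$, we have $$\lim_{k\to\infty}\|A_{i(k)}(k:t_0)-A_{j(k)}(k:t_0)\|=0\quad\text{for any starting time }t_0\ge 0$$ if and only if $i$ and $j$ belong to the same connected component of the infinite flow graph $G^\infty_{\mathcal P}$ of $\{A(k)\}$.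
   Context: $[m]=\{1,\dots,m\}$. A matrix is stochastic if its entries are nonnegative and each row sums to $1$; it is doubly stochastic if both it and its transpose are stochastic. For $k>s\ge 0$, $A(k:s)=A(k-1)A(k-2)\cdots A(s)$ (similarly for $P(k:s)$), and $P(0:0)=I$. $A_\ell(k:t_0)$ denotes the $\ell$th row of $A(k:t_0)$, $e_\ell$ the $\ell$th standard basis vector, and $\|\cdot\|$ the Euclidean norm. A sequence $\{P(k)\}$ of permutation matrices is a permutation component of $\{A(k)\}$ if there are a scalar $\gamma$ with $0<\gamma\le1$, independent of $k$, and a sequence $\{\tilde A(k)\}$ of stochastic matrices such that $A(k)=\gamma P(k)+(1-\gamma)\tilde A(k)$ for all $k\ge0$. The trajectory $\{i(k)\}$ of $\{i\}$ under $\{P(k)\}$ is defined by $e_{i(k)}=P(k:0)e_i$ for $k\ge0$ (similarly for $j$). The infinite flow graph $G^\infty_{\mathcal P}=([m],\mathcal E^\infty_{\mathcal P})$ of $\{A(k)\}$ with respect to the permutation component $\{P(k)\}$ is the undirected graph with edge set $$\mathcal E^\infty_{\mathcal P}=\Big\{\{i,j\}\ \Big|\ \sum_{k=0}^\infty A_{i(k+1),j(k)}(k)=\infty\Big\},$$ where $A_{i(k+1),j(k)}(k)$ is the $(i(k+1),j(k))$ entry of $A(k)$; the pair is unordered, so $\{i,j\}$ is an edge if the sum is infinite for at least one of the two orderings of $i,j$. *)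

theory Defs
  imports "HOL-Analysis.Analysis" "Graph_Theory.Digraph_Component"
begin

text \<open>The index set \<open>[m]\<close> is a finite type \<^typ>\<open>'n\<close>; \<open>M $ i $ j\<close> is the entry in row
  \<open>i\<close> and column \<open>j\<close>.\<close>

definition stochastic :: "real ^ 'n ^ 'n \<Rightarrow> bool" where
  "stochastic M \<longleftrightarrow> (\<forall>i j. 0 \<le> M $ i $ j) \<and> (\<forall>i. (\<Sum>j\<in>UNIV. M $ i $ j) = 1)"

definition doubly_stochastic :: "real ^ 'n ^ 'n \<Rightarrow> bool" where
  "doubly_stochastic M \<longleftrightarrow> stochastic M \<and> stochastic (transpose M)"

definition permutation_matrix :: "real ^ 'n ^ 'n \<Rightarrow> bool" where
  "permutation_matrix M \<longleftrightarrow>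
     (\<forall>i j. M $ i $ j = 0 \<or> M $ i $ j = 1) \<and>
     (\<forall>i. \<exists>!j. M $ i $ j = 1) \<and> (\<forall>j. \<exists>!i. M $ i $ j = 1)"

text \<open>\<open>chain_prod A k s\<close> is \<open>A(k:s) = A(k-1) A(k-2) \<dots> A(s)\<close> for \<open>k > s\<close>; for \<open>k \<le> s\<close> it is
  the identity matrix.\<close>

primrec chain_prod :: "(nat \<Rightarrow> real ^ 'n ^ 'n) \<Rightarrow> nat \<Rightarrow> nat \<Rightarrow> real ^ 'n ^ 'n" where
  "chain_prod A 0 s = mat 1"
| "chain_prod A (Suc k) s = (if s \<le> k then A k ** chain_prod A k s else mat 1)"

definition permutation_component ::
    "(nat \<Rightarrow> real ^ 'n ^ 'n) \<Rightarrow> (nat \<Rightarrow> real ^ 'n ^ 'n) \<Rightarrow> bool" where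
  "permutation_component A P \<longleftrightarrow>
     (\<forall>k. permutation_matrix (P k)) \<and>
     (\<exists>\<gamma> At. 0 < \<gamma> \<and> \<gamma> \<le> 1 \<and> (\<forall>k. stochastic (At k)) \<and>
        (\<forall>k. A k = \<gamma> *\<^sub>R P k + (1 - \<gamma>) *\<^sub>R At k))"

definition trajectory :: "(nat \<Rightarrow> real ^ 'n ^ 'n) \<Rightarrow> 'n \<Rightarrow> nat \<Rightarrow> 'n" where
  "trajectory P i k = (THE l. axis l 1 = chain_prod P k 0 *v axis i 1)"

text \<open>Matrix entries are nonnegative for the chains considered, so no term is truncated by
  \<^const>\<open>ennreal\<close>. The pair \<open>{i, j}\<close> is unordered: one infinite sum in either order suffices.
  Loops \<open>{i}\<close> are not excluded; they do not affect the connected components.\<close>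

definition infinite_flow_edges ::
    "(nat \<Rightarrow> real ^ 'n ^ 'n) \<Rightarrow> (nat \<Rightarrow> real ^ 'n ^ 'n) \<Rightarrow> 'n set set" where
  "infinite_flow_edges A P =
     {{i, j} | i j. (\<Sum>k. ennreal (A k $ trajectory P i (Suc k) $ trajectory P j k)) = \<infinity>}"

text \<open>As usual in the graph library, an undirected graph is represented by the symmetric digraph
  with an arc in each direction for every edge.\<close>

definition infinite_flow_graph ::
    "(nat \<Rightarrow> real ^ 'n ^ 'n) \<Rightarrow> (nat \<Rightarrow> real ^ 'n ^ 'n) \<Rightarrow> ('n, 'n \<times> 'n) pre_digraph" where
  "infinite_flow_graph A P =
     with_proj \<lparr>pverts = UNIV, parcs = {(u, v). {u, v} \<in> infinite_flow_edges A P}\<rparr>"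

text \<open>The strongly connected components of a symmetric digraph are the connected components of the
  undirected graph it represents.\<close>

definition same_connected_component :: "('a, 'b) pre_digraph \<Rightarrow> 'a \<Rightarrow> 'a \<Rightarrow> bool" where
  "same_connected_component G u v \<longleftrightarrow> (\<exists>C \<in> pre_digraph.sccs_verts G. u \<in> C \<and> v \<in> C)"

lemma pseudo_graph_infinite_flow_graph:
  "pseudo_graph (infinite_flow_graph A P :: ('n::finite, 'n \<times> 'n) pre_digraph)"
  by unfold_locales
    (auto simp: infinite_flow_graph_def symmetric_def sym_def arcs_ends_conv insert_commute)

lemma same_connected_component_iff:
  fixes A P :: "nat \<Rightarrow> real ^ 'n ^ 'n"
  shows "same_connected_component (infinite_flow_graph A P) u v \<longleftrightarrow>
    (u, v) \<in> {(u, v). {u, v} \<in> infinite_flow_edges A P}\<^sup>*"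
proof -
  let ?G = "infinite_flow_graph A P"
  interpret pseudo_graph ?G by (rule pseudo_graph_infinite_flow_graph)
  have E: "arcs_ends ?G = {(u, v). {u, v} \<in> infinite_flow_edges A P}"
    by (auto simp: infinite_flow_graph_def arcs_ends_conv)
  have V: "verts ?G = UNIV" by (simp add: infinite_flow_graph_def)
  have R: "x \<rightarrow>\<^sup>*\<^bsub>?G\<^esub> y \<longleftrightarrow> (x, y) \<in> (arcs_ends ?G)\<^sup>*" for x y
    unfolding reachable_def V
    by (auto intro: rtrancl_on_rtranclI rtrancl_consistent_rtrancl_on)
  have sym: "sym ((arcs_ends ?G)\<^sup>*)"
    using sym_arcs unfolding symmetric_def by (rule sym_rtrancl)
  have *: "(u, v) \<in> (arcs_ends ?G)\<^sup>*" if "same_connected_component ?G u v"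
    using that unfolding same_connected_component_def sccs_verts_def R by blast
  have **: "same_connected_component ?G u v" if uv: "(u, v) \<in> (arcs_ends ?G)\<^sup>*"
    unfolding same_connected_component_def
  proof
    show "u \<in> scc_of u \<and> v \<in> scc_of u"
      using uv sym by (auto simp: scc_of_def R dest: symD)
    show "scc_of u \<in> sccs_verts"
      unfolding sccs_verts_def scc_of_def R
      by (auto intro: rtrancl_trans)
  qed
  show ?thesis using * ** unfolding E by blast
qed

end

theory Submission
  imports Defs
begin

text \<open>
  Relabel rows and columns of \<open>A(k)\<close> along the trajectories of \<open>P\<close>: let the entry \<open>B\<^sub>i\<^sub>j(k)\<close> of
  \<open>B(k)\<close> be the entry of \<open>A(k)\<close> in row \<open>i(k+1)\<close> and column \<open>j(k)\<close>. These matrices are again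
  doubly stochastic, and the permutation component becomes a uniform lower bound \<open>\<gamma>\<close> on their
  diagonals. The row \<open>i(k)\<close> of \<open>A(k:t\<^sub>0)\<close> applied to a vector \<open>x\<close> is then the component \<open>y\<^sub>i(k)\<close> of a
  solution of \<open>y(k+1) = B(k) y(k)\<close>, so both claims become claims about such solutions.

  Convergence of \<open>y\<^sub>i\<close> combines two facts. Since \<open>B(k)\<close> is doubly stochastic, sums of convex
  functions of the components decrease; hence the values of \<open>y(k)\<close>, as a multiset, settle
  down, and only finitely many reals are limit points of components
  (\<open>finitely_many_limit_values\<close>). The energy, the sum of squares of the components, decreases by
  the sum of all \<open>B\<^sub>i\<^sub>j(k) (y\<^sub>j(k) - y\<^sub>i(k+1))\<^sup>2\<close>, so each of these quantities is summable over \<open>k\<close>;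
  with \<open>i = j\<close> and the bound \<open>\<gamma>\<close> this makes the increments of \<open>y\<^sub>i\<close> vanish. A sequence
  with vanishing increments cannot keep moving between finitely many separated values, so it
  converges (\<open>averaging_converges\<close>).

  The same summability shows that \<open>y\<^sub>i\<close> and \<open>y\<^sub>j\<close> have the same limit when the entries
  \<open>B\<^sub>i\<^sub>j(k)\<close> are not summable (\<open>infinite_flow_imp_equal_limits\<close>), and this passes along paths of the
  infinite flow graph. Conversely, only a finite total weight crosses the boundary of a connected
  component \<open>S\<close>. From a time after which less than one half is left, start \<open>y\<close> at the indicator
  of \<open>S\<close>: inside and outside values then stay at least one half apart
  (\<open>indicator_separation\<close>).
\<close>

section \<open>Averaging by doubly stochastic chains with positive diagonal\<close>

definition averaging :: "(nat \<Rightarrow> 'n \<Rightarrow> 'n \<Rightarrow> real) \<Rightarrow> (nat \<Rightarrow> 'n::finite \<Rightarrow> real) \<Rightarrow> bool" where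
  "averaging B y \<longleftrightarrow> (\<forall>k i. y (Suc k) i = (\<Sum>j\<in>UNIV. B k i j * y k j))"

locale positive_diagonal_chain =
  fixes B :: "nat \<Rightarrow> 'n::finite \<Rightarrow> 'n \<Rightarrow> real" and \<gamma> :: real
  assumes nonneg: "0 \<le> B k i j"
    and row_sum: "(\<Sum>j\<in>UNIV. B k i j) = 1"
    and col_sum: "(\<Sum>i\<in>UNIV. B k i j) = 1"
    and \<gamma>_pos: "0 < \<gamma>"
    and diagonal: "\<gamma> \<le> B k i i"
begin

lemma shifted_chain: "positive_diagonal_chain (\<lambda>k. B (k + s)) \<gamma>"
  by unfold_locales (auto simp: nonneg row_sum col_sum \<gamma>_pos diagonal)

lemma double_sum_weight: "(\<Sum>i\<in>UNIV. \<Sum>j\<in>UNIV. B k i j * f j) = (\<Sum>j\<in>UNIV. f j)"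
  by (subst sum.swap) (simp add: col_sum flip: sum_distrib_right)

lemma averaging_diff_const:
  assumes "averaging B y"
  shows "y (Suc k) i - c = (\<Sum>j\<in>UNIV. B k i j * (y k j - c))"
  using assms row_sum[of k i]
  by (simp add: averaging_def algebra_simps sum_subtractf flip: sum_distrib_left)

lemma averaging_complement:
  assumes "averaging B y"
  shows "averaging B (\<lambda>k i. 1 - y k i)"
  unfolding averaging_def
proof (intro allI)
  fix k i
  show "1 - y (Suc k) i = (\<Sum>j\<in>UNIV. B k i j * (1 - y k j))"
    using averaging_diff_const[OF assms, of k i 1] by (simp add: algebra_simps sum_subtractf)
qed

text \<open>The triangle inequality needs only unit row sums; summing over the components uses unit
  column sums.\<close>

lemma sum_abs_deviation_decseq:
  assumes "averaging B y"
  shows "decseq (\<lambda>k. \<Sum>i\<in>UNIV. \<bar>y k i - c\<bar>)"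
proof (rule decseq_SucI)
  fix k
  have "\<bar>y (Suc k) i - c\<bar> \<le> (\<Sum>j\<in>UNIV. B k i j * \<bar>y k j - c\<bar>)" for i
    unfolding averaging_diff_const[OF assms]
    by (rule order.trans[OF sum_abs]) (simp add: abs_mult nonneg)
  hence "(\<Sum>i\<in>UNIV. \<bar>y (Suc k) i - c\<bar>) \<le> (\<Sum>i\<in>UNIV. \<Sum>j\<in>UNIV. B k i j * \<bar>y k j - c\<bar>)"
    by (intro sum_mono)
  thus "(\<Sum>i\<in>UNIV. \<bar>y (Suc k) i - c\<bar>) \<le> (\<Sum>i\<in>UNIV. \<bar>y k i - c\<bar>)"
    by (simp add: double_sum_weight)
qed

lemma averaging_bounded:
  assumes "averaging B y"
  shows "\<bar>y k i\<bar> \<le> (\<Sum>i\<in>UNIV. \<bar>y 0 i\<bar>)"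
proof -
  have "\<bar>y k i\<bar> \<le> (\<Sum>i\<in>UNIV. \<bar>y k i\<bar>)"
    by (rule member_le_sum) auto
  also have "\<dots> \<le> (\<Sum>i\<in>UNIV. \<bar>y 0 i\<bar>)"
    using decseqD[OF sum_abs_deviation_decseq[OF assms, of 0], of 0 k] by simp
  finally show ?thesis .
qed

text \<open>A hat is zero at distance at least \<open>h\<close> from \<open>c\<close>, so this sum detects whether some
  component is close to \<open>c\<close>. Hats are not convex, but they are combinations of absolute
  deviations, whose sums converge by monotonicity.\<close>

lemma hat_sum_convergent:
  assumes "averaging B y" and "0 \<le> h"
  shows "convergent (\<lambda>k. \<Sum>i\<in>UNIV. max 0 (h - \<bar>y k i - c\<bar>))"
proof -
  have "convergent (\<lambda>k. \<Sum>i\<in>UNIV. \<bar>y k i - c'\<bar>)" for c'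
    using decseq_convergent[OF sum_abs_deviation_decseq[OF assms(1)], of 0 c']
    by (metis convergentI sum_nonneg abs_ge_zero)
  then obtain D where D: "(\<lambda>k. \<Sum>i\<in>UNIV. \<bar>y k i - c'\<bar>) \<longlonglongrightarrow> D c'" for c'
    unfolding convergent_def by metis
  \<comment> \<open>A hat is half the second difference of the absolute value.\<close>
  have "max 0 (h - \<bar>y k i - c\<bar>) =
      (\<bar>y k i - (c + h)\<bar> + \<bar>y k i - (c - h)\<bar> - 2 * \<bar>y k i - c\<bar>) / 2" for k i
    using assms(2) by (simp add: max_def abs_if)
  hence eq: "(\<Sum>i\<in>UNIV. max 0 (h - \<bar>y k i - c\<bar>)) =
      ((\<Sum>i\<in>UNIV. \<bar>y k i - (c + h)\<bar>) + (\<Sum>i\<in>UNIV. \<bar>y k i - (c - h)\<bar>)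
        - 2 * (\<Sum>i\<in>UNIV. \<bar>y k i - c\<bar>)) / 2" for k
    by (simp only: sum.distrib sum_subtractf sum_distrib_left sum_divide_distrib
        add_divide_distrib diff_divide_distrib)
  have "(\<lambda>k. ((\<Sum>i\<in>UNIV. \<bar>y k i - (c + h)\<bar>) + (\<Sum>i\<in>UNIV. \<bar>y k i - (c - h)\<bar>)
        - 2 * (\<Sum>i\<in>UNIV. \<bar>y k i - c\<bar>)) / 2)
      \<longlonglongrightarrow> (D (c + h) + D (c - h) - 2 * D c) / 2"
    by (intro tendsto_intros D) simp
  thus ?thesis unfolding eq by (rule convergentI)
qed

text \<open>The new value \<open>y (Suc k) i\<close> is the mean of the old values under the weights
  \<open>B k i j\<close>; the inner sum on the right is the variance of the old values under these weights.\<close>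

lemma energy_dissipation:
  assumes "averaging B y"
  shows "(\<Sum>i\<in>UNIV. (y k i)\<^sup>2) - (\<Sum>i\<in>UNIV. (y (Suc k) i)\<^sup>2) =
    (\<Sum>i\<in>UNIV. \<Sum>j\<in>UNIV. B k i j * (y k j - y (Suc k) i)\<^sup>2)"
proof -
  have "(\<Sum>j\<in>UNIV. B k i j * (y k j - y (Suc k) i)\<^sup>2) =
      (\<Sum>j\<in>UNIV. B k i j * (y k j)\<^sup>2) - (y (Suc k) i)\<^sup>2" for i
  proof -
    let ?z = "y (Suc k) i"
    have z: "(\<Sum>j\<in>UNIV. B k i j * y k j) = ?z"
      using assms by (simp add: averaging_def)
    have "(\<Sum>j\<in>UNIV. B k i j * (y k j - ?z)\<^sup>2) =
        (\<Sum>j\<in>UNIV. B k i j * (y k j)\<^sup>2) - 2 * ?z * (\<Sum>j\<in>UNIV. B k i j * y k j)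
          + ?z\<^sup>2 * (\<Sum>j\<in>UNIV. B k i j)"
      by (simp add: power2_eq_square algebra_simps sum.distrib sum_subtractf sum_distrib_left)
    thus ?thesis
      unfolding z row_sum by (simp add: power2_eq_square)
  qed
  thus ?thesis by (simp add: sum_subtractf double_sum_weight)
qed

lemma dissipation_summable:
  assumes "averaging B y"
  shows "summable (\<lambda>k. B k i j * (y k j - y (Suc k) i)\<^sup>2)"
proof (rule bounded_imp_summable)
  let ?V = "\<lambda>k. \<Sum>i\<in>UNIV. (y k i)\<^sup>2"
  show "0 \<le> B k i j * (y k j - y (Suc k) i)\<^sup>2" for k
    by (simp add: nonneg)
  have le: "B k i j * (y k j - y (Suc k) i)\<^sup>2 \<le> ?V k - ?V (Suc k)" for k
  proof -
    have "B k i j * (y k j - y (Suc k) i)\<^sup>2 \<le> (\<Sum>j\<in>UNIV. B k i j * (y k j - y (Suc k) i)\<^sup>2)"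
      by (rule member_le_sum[where f = "\<lambda>j. B k i j * (y k j - y (Suc k) i)\<^sup>2"])
        (simp_all add: nonneg)
    also have "\<dots> \<le> (\<Sum>i\<in>UNIV. \<Sum>j\<in>UNIV. B k i j * (y k j - y (Suc k) i)\<^sup>2)"
      by (rule member_le_sum[where f = "\<lambda>i. \<Sum>j\<in>UNIV. B k i j * (y k j - y (Suc k) i)\<^sup>2"])
        (simp_all add: nonneg sum_nonneg)
    finally show ?thesis
      by (simp add: energy_dissipation[OF assms])
  qed
  fix n
  have "(\<Sum>k\<le>n. B k i j * (y k j - y (Suc k) i)\<^sup>2) \<le> (\<Sum>k\<le>n. ?V k - ?V (Suc k))"
    by (intro sum_mono le)
  also have "\<dots> = ?V 0 - ?V (Suc n)"
    by (rule sum_telescope)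
  also have "\<dots> \<le> ?V 0"
    by (simp add: sum_nonneg)
  finally show "(\<Sum>k\<le>n. B k i j * (y k j - y (Suc k) i)\<^sup>2) \<le> ?V 0" .
qed

text \<open>This is where the diagonal bound enters: it turns the term with \<open>j = i\<close> of the summable
  dissipation into a bound on the increment.\<close>

lemma increment_tendsto_0:
  assumes "averaging B y"
  shows "(\<lambda>k. y (Suc k) i - y k i) \<longlonglongrightarrow> 0"
proof -
  have "(\<lambda>k. (y k i - y (Suc k) i)\<^sup>2) \<longlonglongrightarrow> 0"
  proof (rule tendsto_sandwich[where f = "\<lambda>_. 0"])
    show "(\<lambda>k. B k i i * (y k i - y (Suc k) i)\<^sup>2 / \<gamma>) \<longlonglongrightarrow> 0"
      using tendsto_divide_zero[OF summable_LIMSEQ_zero[OF dissipation_summable[OF assms]]] .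
    have "(y k i - y (Suc k) i)\<^sup>2 \<le> B k i i * (y k i - y (Suc k) i)\<^sup>2 / \<gamma>" for k
      using mult_right_mono[OF diagonal[of k i], of "(y k i - y (Suc k) i)\<^sup>2"] \<gamma>_pos
      by (simp add: field_simps)
    thus "\<forall>\<^sub>F k in sequentially.
        (y k i - y (Suc k) i)\<^sup>2 \<le> B k i i * (y k i - y (Suc k) i)\<^sup>2 / \<gamma>"
      by simp
  qed (auto intro: tendsto_const)
  hence "(\<lambda>k. y k i - y (Suc k) i) \<longlonglongrightarrow> 0"
    by simp
  from tendsto_minus[OF this] show ?thesis by simp
qed

text \<open>The finite set is the range of an accumulation point \<open>Y\<close> of the whole vector. Away from this
  range the hat sums tend to zero along the subsequence that leads to \<open>Y\<close>; since they converge,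
  they tend to zero along all times, so eventually no component is near such a value.\<close>

lemma finitely_many_limit_values:
  assumes "averaging B y"
  obtains Y r where "strict_mono r" and "\<And>i. (\<lambda>k. y (r k) i) \<longlonglongrightarrow> Y i"
    and "\<And>c i. c \<notin> range Y \<Longrightarrow> \<exists>\<eta>>0. \<forall>\<^sub>F k in sequentially. \<eta> < \<bar>y k i - c\<bar>"
proof -
  let ?f = "\<lambda>k. \<chi> i. y k i"
  have "norm (?f k) \<le> (\<Sum>i\<in>(UNIV::'n set). \<Sum>i\<in>UNIV. \<bar>y 0 i\<bar>)" for k
  proof -
    have "norm (?f k) \<le> (\<Sum>i\<in>UNIV. \<bar>?f k $ i\<bar>)"
      by (rule norm_le_l1_cart)
    also have "\<dots> \<le> (\<Sum>i\<in>(UNIV::'n set). \<Sum>i\<in>UNIV. \<bar>y 0 i\<bar>)"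
      by (rule sum_mono) (simp add: averaging_bounded[OF assms])
    finally show ?thesis .
  qed
  hence "bounded (range ?f)"
    unfolding bounded_iff by blast
  then obtain Y r where r: "strict_mono r" and lim: "(?f \<circ> r) \<longlonglongrightarrow> Y"
    using bounded_imp_convergent_subsequence by blast
  have lim_i: "(\<lambda>k. y (r k) i) \<longlonglongrightarrow> Y $ i" for i
    using tendsto_vec_nth[OF lim, of i] by (simp add: o_def)
  have "\<exists>\<eta>>0. \<forall>\<^sub>F k in sequentially. \<eta> < \<bar>y k i - c\<bar>" if c: "c \<notin> range (($) Y)" for c i
  proof -
    define h where "h = Min (range (\<lambda>i. \<bar>Y $ i - c\<bar>))"
    have h_le: "h \<le> \<bar>Y $ i - c\<bar>" for i
      unfolding h_def by (rule Min_le) auto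
    have h: "h > 0"
      unfolding h_def using c by (auto simp: Min_gr_iff)
    let ?F = "\<lambda>k. \<Sum>i\<in>UNIV. max 0 (h - \<bar>y k i - c\<bar>)"
    obtain L where L: "?F \<longlonglongrightarrow> L"
      using hat_sum_convergent[OF assms, of h c] h by (auto simp: convergent_def)
    have "(\<lambda>k. ?F (r k)) \<longlonglongrightarrow> (\<Sum>i\<in>UNIV. max 0 (h - \<bar>Y $ i - c\<bar>))"
      by (intro tendsto_intros lim_i)
    also have "(\<Sum>i\<in>UNIV. max 0 (h - \<bar>Y $ i - c\<bar>)) = 0"
      by (intro sum.neutral ballI) (use h_le in \<open>simp add: max_absorb1\<close>)
    finally have "L = 0"
      using LIMSEQ_subseq_LIMSEQ[OF L r] LIMSEQ_unique by (force simp: o_def)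
    hence "\<forall>\<^sub>F k in sequentially. ?F k < h / 2"
      using L h by (intro order_tendstoD(2)) auto
    hence "\<forall>\<^sub>F k in sequentially. h / 2 < \<bar>y k i - c\<bar>"
    proof eventually_elim
      case (elim k)
      have "max 0 (h - \<bar>y k i - c\<bar>) \<le> ?F k"
        by (rule member_le_sum[where f = "\<lambda>i. max 0 (h - \<bar>y k i - c\<bar>)"]) auto
      with elim show ?case by linarith
    qed
    with h show ?thesis by (intro exI[of _ "h / 2"]) auto
  qed
  thus ?thesis by (rule that[OF r lim_i])
qed

text \<open>The limit is the component \<open>Y i\<close> of the accumulation point: arbitrarily close to \<open>Y i\<close> there
  are two avoided values \<open>Y i - d\<close> and \<open>Y i + d\<close>. Once the sequence is between them with
  increments too small to jump over the avoided neighbourhoods, it stays there.\<close>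

theorem averaging_converges:
  assumes "averaging B y"
  shows "convergent (\<lambda>k. y k i)"
proof -
  obtain Y r where r: "strict_mono r" and lim: "\<And>i. (\<lambda>k. y (r k) i) \<longlonglongrightarrow> Y i"
    and avoid: "\<And>c i. c \<notin> range Y \<Longrightarrow> \<exists>\<eta>>0. \<forall>\<^sub>F k in sequentially. \<eta> < \<bar>y k i - c\<bar>"
    by (rule finitely_many_limit_values[OF assms]) blast
  let ?w = "\<lambda>k. \<bar>y k i - Y i\<bar>"
  have "\<forall>\<^sub>F k in sequentially. ?w k < e" if e: "e > 0" for e
  proof -
    have "infinite ({0<..<e} - ((\<lambda>v. v - Y i) ` range Y \<union> (\<lambda>v. Y i - v) ` range Y))"
      using e by (intro Diff_infinite_finite) auto
    then obtain d where d: "d \<in> {0<..<e} - ((\<lambda>v. v - Y i) ` range Y \<union> (\<lambda>v. Y i - v) ` range Y)"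
      by (metis finite.emptyI ex_in_conv)
    hence d_pos: "0 < d" and d_less: "d < e" by auto
    have "Y i + d \<notin> range Y"
    proof
      assume "Y i + d \<in> range Y"
      hence "(Y i + d) - Y i \<in> (\<lambda>v. v - Y i) ` range Y" by (rule imageI)
      with d show False by simp
    qed
    then obtain \<eta>1 where \<eta>1: "\<eta>1 > 0" "\<forall>\<^sub>F k in sequentially. \<eta>1 < \<bar>y k i - (Y i + d)\<bar>"
      using avoid by blast
    have "Y i - d \<notin> range Y"
    proof
      assume "Y i - d \<in> range Y"
      hence "Y i - (Y i - d) \<in> (\<lambda>v. Y i - v) ` range Y" by (rule imageI)
      with d show False by simp
    qed
    then obtain \<eta>2 where \<eta>2: "\<eta>2 > 0" "\<forall>\<^sub>F k in sequentially. \<eta>2 < \<bar>y k i - (Y i - d)\<bar>"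
      using avoid by blast
    define \<eta> where "\<eta> = min \<eta>1 \<eta>2"
    have "\<eta> > 0" using \<eta>1 \<eta>2 by (simp add: \<eta>_def)
    have "\<forall>\<^sub>F k in sequentially. \<bar>y (Suc k) i - y k i\<bar> < \<eta>"
      using tendstoD[OF increment_tendsto_0[OF assms] \<open>\<eta> > 0\<close>] by (simp add: dist_real_def)
    hence "\<forall>\<^sub>F k in sequentially. ?w k < d \<longrightarrow> ?w (Suc k) < d"
      using \<eta>1(2) \<eta>2(2)
    proof eventually_elim
      case (elim k)
      moreover have "\<eta> \<le> \<eta>1" "\<eta> \<le> \<eta>2" by (simp_all add: \<eta>_def)
      ultimately show ?case by linarith
    qed
    then obtain N where N: "\<And>k. N \<le> k \<Longrightarrow> ?w k < d \<Longrightarrow> ?w (Suc k) < d"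
      unfolding eventually_sequentially by blast
    have "\<forall>\<^sub>F k in sequentially. \<bar>y (r k) i - Y i\<bar> < d"
      using tendstoD[OF lim d_pos, of i] by (simp add: dist_real_def)
    then obtain M where M: "\<And>k. M \<le> k \<Longrightarrow> ?w (r k) < d"
      unfolding eventually_sequentially by blast
    have start: "N \<le> r (max M N)" "?w (r (max M N)) < d"
      using seq_suble[OF r, of "max M N"] M[of "max M N"] by auto
    have "?w k < d" if "r (max M N) \<le> k" for k
      using that
    proof (induction rule: dec_induct)
      case (step n)
      from step.hyps(1) start(1) have "N \<le> n" by linarith
      from N[OF this step.IH] show ?case .
    qed (fact start)
    hence "?w k < e" if "r (max M N) \<le> k" for k
      using that d_less by fastforce
    thus ?thesis
      unfolding eventually_sequentially by blast
  qed
  hence "(\<lambda>k. y k i) \<longlonglongrightarrow> Y i"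
    by (auto simp: tendsto_iff dist_real_def)
  thus ?thesis by (rule convergentI)
qed

section \<open>Infinite flow and limits\<close>

text \<open>If the limits differed, the factors \<open>(y k j - y (Suc k) i)\<^sup>2\<close> of the summable dissipation would
  be bounded away from zero, and \<open>B k i j\<close> would be summable.\<close>

lemma infinite_flow_imp_equal_limits:
  assumes "averaging B y" and "\<not> summable (\<lambda>k. B k i j)"
  shows "(\<lambda>k. y k i - y k j) \<longlonglongrightarrow> 0"
proof -
  obtain a where a: "(\<lambda>k. y k i) \<longlonglongrightarrow> a"
    using averaging_converges[OF assms(1)] by (auto simp: convergent_def)
  obtain b where b: "(\<lambda>k. y k j) \<longlonglongrightarrow> b"
    using averaging_converges[OF assms(1)] by (auto simp: convergent_def)
  have "a = b"
  proof (rule ccontr)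
    assume "a \<noteq> b"
    hence pos: "0 < (b - a)\<^sup>2" by simp
    have "(\<lambda>k. (y k j - y (Suc k) i)\<^sup>2) \<longlonglongrightarrow> (b - a)\<^sup>2"
      using LIMSEQ_Suc[OF a] by (intro tendsto_intros b)
    hence "\<forall>\<^sub>F k in sequentially. (b - a)\<^sup>2 / 2 < (y k j - y (Suc k) i)\<^sup>2"
      by (rule order_tendstoD(1)) (use pos in simp)
    hence "\<forall>\<^sub>F k in sequentially.
        norm (B k i j) \<le> B k i j * (y k j - y (Suc k) i)\<^sup>2 * (2 / (b - a)\<^sup>2)"
    proof eventually_elim
      case (elim k)
      hence "B k i j * ((b - a)\<^sup>2 / 2) \<le> B k i j * (y k j - y (Suc k) i)\<^sup>2"
        by (intro mult_left_mono) (auto simp: nonneg)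
      thus ?case using pos nonneg[of k i j] by (simp add: field_simps)
    qed
    hence "summable (\<lambda>k. B k i j)"
      by (rule summable_comparison_test_ev)
        (intro summable_mult2 dissipation_summable[OF assms(1)])
    with assms(2) show False ..
  qed
  thus ?thesis using tendsto_diff[OF a b] by simp
qed

definition outflow :: "'n set \<Rightarrow> nat \<Rightarrow> real" where
  "outflow S k = (\<Sum>a\<in>S. \<Sum>b\<in>-S. B k a b)"

lemma outflow_nonneg: "0 \<le> outflow S k"
  by (simp add: outflow_def sum_nonneg nonneg)

text \<open>In one step a component of \<open>S\<close> averages values that are at least the current bound over \<open>S\<close>
  and values that are at least \<open>0\<close> outside of \<open>S\<close>, the latter with weight at most the
  outflow.\<close>

lemma indicator_decay_bound:
  assumes "averaging B y" and y0: "\<And>i. y 0 i = of_bool (i \<in> S)" and "i \<in> S"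
  shows "1 - (\<Sum>t<k. outflow S t) \<le> y k i"
  using \<open>i \<in> S\<close>
proof (induction k arbitrary: i)
  case 0
  thus ?case by (simp add: y0)
next
  case (Suc k)
  have y_nonneg: "0 \<le> y k j" for j
  proof (induction k arbitrary: j)
    case (Suc k)
    thus ?case using assms(1) by (auto simp: averaging_def nonneg intro!: sum_nonneg)
  qed (simp add: y0)
  let ?s = "\<Sum>t<k. outflow S t" and ?l = "\<Sum>b\<in>-S. B k i b"
  have split: "(\<Sum>b\<in>UNIV. f b) = (\<Sum>b\<in>S. f b) + (\<Sum>b\<in>-S. f b)" for f :: "'n \<Rightarrow> real"
    by (subst sum.union_disjoint[symmetric]) (auto simp: Compl_partition)
  have l: "0 \<le> ?l" "?l \<le> outflow S k"
    using member_le_sum[of i S "\<lambda>a. \<Sum>b\<in>-S. B k a b"] Suc.prems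
    by (auto simp: outflow_def nonneg sum_nonneg)
  have "0 \<le> ?s" by (simp add: sum_nonneg outflow_nonneg)
  hence "0 \<le> ?s * ?l" using l by simp
  hence "1 - (?s + outflow S k) \<le> (1 - ?s) * (1 - ?l)"
    using l by (simp add: algebra_simps)
  also have "\<dots> = (\<Sum>b\<in>S. B k i b * (1 - ?s))"
    using row_sum[of k i] by (simp add: split sum_distrib_right[symmetric])
  also have "\<dots> \<le> (\<Sum>b\<in>S. B k i b * y k b)"
    using Suc.IH by (intro sum_mono mult_left_mono) (auto simp: nonneg)
  also have "\<dots> \<le> (\<Sum>b\<in>UNIV. B k i b * y k b)"
    by (intro sum_mono2) (auto simp: nonneg y_nonneg)
  also have "\<dots> = y (Suc k) i"
    using assms(1) by (simp add: averaging_def)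
  finally show ?case by simp
qed

text \<open>The values outside of \<open>S\<close> are controlled by the complement \<open>1 - y\<close>, a solution that starts
  at the indicator of \<open>- S\<close>.\<close>

lemma indicator_separation:
  assumes "averaging B y" and "\<And>i. y 0 i = of_bool (i \<in> S)" and "i \<in> S" and "j \<notin> S"
  shows "1 - (\<Sum>t<k. outflow S t + outflow (- S) t) \<le> y k i - y k j"
proof -
  have "1 - y 0 i = of_bool (i \<in> - S)" for i
    by (simp add: assms(2))
  from indicator_decay_bound[OF averaging_complement[OF assms(1)] this, of j k]
  have "1 - (\<Sum>t<k. outflow (- S) t) \<le> 1 - y k j"
    using assms(4) by simp
  with indicator_decay_bound[OF assms(1-3), of k] show ?thesis
    by (simp add: sum.distrib)
qed

end

section \<open>Following the permutation component\<close>

lemma permutation_matrix_mult_axis: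
  fixes M :: "real ^ 'n ^ 'n"
  assumes "permutation_matrix M"
  shows "M *v axis j 1 = axis l 1 \<longleftrightarrow> M $ l $ j = 1"
proof -
  have "M *v axis j 1 = axis l 1 \<longleftrightarrow> (\<forall>i. M $ i $ j = (if i = l then 1 else 0))"
    by (simp add: vec_eq_iff axis_def matrix_vector_mult_def mult_delta_right)
  also have "\<dots> \<longleftrightarrow> M $ l $ j = 1"
    using assms unfolding permutation_matrix_def by metis
  finally show ?thesis .
qed

context
  fixes P :: "nat \<Rightarrow> real ^ 'n ^ 'n"
  assumes perm: "\<And>k. permutation_matrix (P k)"
begin

lemma chain_prod_mult_axis: "chain_prod P k 0 *v axis i 1 = axis (trajectory P i k) 1"
proof -
  have "\<exists>l. axis l 1 = chain_prod P k 0 *v axis i 1"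
  proof (induction k)
    case (Suc k)
    then obtain l where "axis l 1 = chain_prod P k 0 *v axis i 1" by blast
    hence "chain_prod P (Suc k) 0 *v axis i 1 = P k *v axis l 1"
      by (simp flip: matrix_vector_mul_assoc)
    moreover obtain l' where "P k $ l' $ l = 1"
      using perm[of k] unfolding permutation_matrix_def by blast
    ultimately show ?case
      using permutation_matrix_mult_axis[OF perm] by metis
  qed auto
  hence "\<exists>!l. axis l 1 = chain_prod P k 0 *v axis i (1::real)"
    by (metis axis_eq_axis zero_neq_one)
  from theI'[OF this] show ?thesis
    unfolding trajectory_def by simp
qed

lemma trajectory_step: "P k $ trajectory P i (Suc k) $ trajectory P i k = 1"
proof -
  have "axis (trajectory P i (Suc k)) 1 = P k *v axis (trajectory P i k) 1"
    unfolding chain_prod_mult_axis[symmetric] by (simp add: matrix_vector_mul_assoc)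
  thus ?thesis using permutation_matrix_mult_axis[OF perm] by metis
qed

lemma bij_trajectory: "bij (\<lambda>i. trajectory P i k)"
proof -
  have "inj (\<lambda>i. trajectory P i k)"
  proof (induction k)
    case 0
    have "trajectory P i 0 = i" for i
      using chain_prod_mult_axis[of 0 i] by (simp add: axis_eq_axis)
    thus ?case by (simp add: inj_def)
  next
    case (Suc k)
    show ?case
    proof (rule injI)
      fix i j assume "trajectory P i (Suc k) = trajectory P j (Suc k)"
      hence "trajectory P i k = trajectory P j k"
        using trajectory_step[of k i] trajectory_step[of k j] perm[of k]
        unfolding permutation_matrix_def by metis
      thus "i = j" using Suc by (auto dest: injD)
    qed
  qed
  thus ?thesis by (simp add: bij_def finite_UNIV_inj_surj)
qed

end

text \<open>The chain of \<open>A\<close> seen by observers that move along the trajectories of \<open>P\<close>; its entry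
  \<open>(i, j)\<close> is the term summed in the definition of the infinite flow graph.\<close>

definition relabelled ::
    "(nat \<Rightarrow> real ^ 'n ^ 'n) \<Rightarrow> (nat \<Rightarrow> real ^ 'n ^ 'n) \<Rightarrow> nat \<Rightarrow> 'n \<Rightarrow> 'n \<Rightarrow> real" where
  "relabelled A P k i j = A k $ trajectory P i (Suc k) $ trajectory P j k"

lemma relabelled_positive_diagonal_chain:
  fixes A P :: "nat \<Rightarrow> real ^ 'n ^ 'n"
  assumes ds: "\<And>k. doubly_stochastic (A k)" and "permutation_component A P"
  obtains \<gamma> where "positive_diagonal_chain (relabelled A P) \<gamma>"
proof -
  from assms(2) obtain \<gamma> At where perm: "\<And>k. permutation_matrix (P k)"
    and \<gamma>: "0 < \<gamma>" "\<gamma> \<le> 1" and At: "\<And>k. stochastic (At k)"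
    and A: "\<And>k. A k = \<gamma> *\<^sub>R P k + (1 - \<gamma>) *\<^sub>R At k"
    unfolding permutation_component_def by blast
  note bij = bij_trajectory[of P, OF perm]
  have "positive_diagonal_chain (relabelled A P) \<gamma>"
  proof
    fix k i j
    show "0 \<le> relabelled A P k i j"
      using ds[of k] by (simp add: relabelled_def doubly_stochastic_def stochastic_def)
    have "(\<Sum>j\<in>UNIV. relabelled A P k i j) = (\<Sum>j\<in>UNIV. A k $ trajectory P i (Suc k) $ j)"
      unfolding relabelled_def by (rule sum.reindex_bij_betw[OF bij])
    thus "(\<Sum>j\<in>UNIV. relabelled A P k i j) = 1"
      using ds[of k] by (simp add: doubly_stochastic_def stochastic_def)
    have "(\<Sum>i\<in>UNIV. relabelled A P k i j) = (\<Sum>i\<in>UNIV. A k $ i $ trajectory P j k)"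
      unfolding relabelled_def by (rule sum.reindex_bij_betw[OF bij])
    thus "(\<Sum>i\<in>UNIV. relabelled A P k i j) = 1"
      using ds[of k] by (simp add: doubly_stochastic_def stochastic_def transpose_def)
    have "P k $ trajectory P i (Suc k) $ trajectory P i k = 1"
      by (rule trajectory_step[of P, OF perm])
    thus "\<gamma> \<le> relabelled A P k i i"
      using \<gamma> At[of k] by (simp add: relabelled_def A stochastic_def)
  qed (fact \<gamma>)
  thus ?thesis by (rule that)
qed

text \<open>The shift by \<open>s\<close> makes the solution start at time \<open>0\<close>, when the product is the identity.\<close>

lemma relabelled_averaging:
  fixes A P :: "nat \<Rightarrow> real ^ 'n ^ 'n"
  assumes "\<And>k. permutation_matrix (P k)"
  shows "averaging (\<lambda>k. relabelled A P (k + s))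
    (\<lambda>k i. (chain_prod A (k + s) s *v x) $ trajectory P i (k + s))"
  unfolding averaging_def
proof (intro allI)
  fix k i
  let ?z = "chain_prod A (k + s) s *v x"
  have "chain_prod A (Suc k + s) s *v x = A (k + s) *v ?z"
    by (simp add: matrix_vector_mul_assoc)
  hence "(chain_prod A (Suc k + s) s *v x) $ trajectory P i (Suc k + s) =
      (\<Sum>j\<in>UNIV. A (k + s) $ trajectory P i (Suc (k + s)) $ j * ?z $ j)"
    by (simp add: matrix_vector_mult_def)
  also have "\<dots> = (\<Sum>j\<in>UNIV. relabelled A P (k + s) i j * ?z $ trajectory P j (k + s))"
    unfolding relabelled_def
    by (rule sum.reindex_bij_betw[OF bij_trajectory[of P, OF assms], symmetric])
  finally show "(chain_prod A (Suc k + s) s *v x) $ trajectory P i (Suc k + s) =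
      (\<Sum>j\<in>UNIV. relabelled A P (k + s) i j * ?z $ trajectory P j (k + s))" .
qed

lemma chain_prod_start: "chain_prod A s s = mat 1"
  by (cases s) auto

lemma permutation_matrix_of_bij:
  assumes "bij \<sigma>"
  shows "permutation_matrix (\<chi> i j. if j = \<sigma> i then 1 else (0 :: real))"
proof -
  have "\<exists>!i. j = \<sigma> i" for j
    using assms by (metis bij_pointE)
  thus ?thesis
    by (simp add: permutation_matrix_def)
qed

lemma row_selection:
  "((\<chi> i j. if j = \<sigma> i then 1 else (0 :: real)) ** M) $ i $ l = M $ \<sigma> i $ l"
  by (simp add: matrix_matrix_mult_def mult_delta_left)

lemma infinite_flow_edge_iff:
  fixes A P :: "nat \<Rightarrow> real ^ 'n ^ 'n"
  assumes "\<And>k i j. 0 \<le> relabelled A P k i j"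
  shows "{i, j} \<in> infinite_flow_edges A P \<longleftrightarrow>
    \<not> summable (\<lambda>k. relabelled A P k i j) \<or> \<not> summable (\<lambda>k. relabelled A P k j i)"
proof -
  have flow: "(\<Sum>k. ennreal (A k $ trajectory P a (Suc k) $ trajectory P b k)) = \<infinity> \<longleftrightarrow>
      \<not> summable (\<lambda>k. relabelled A P k a b)" for a b
  proof -
    have "summable (\<lambda>k. relabelled A P k a b) \<longleftrightarrow> (\<Sum>k. ennreal (relabelled A P k a b)) \<noteq> top"
    proof
      assume "summable (\<lambda>k. relabelled A P k a b)"
      from suminf_ennreal2[OF assms this]
      show "(\<Sum>k. ennreal (relabelled A P k a b)) \<noteq> top" by simp
    next
      assume "(\<Sum>k. ennreal (relabelled A P k a b)) \<noteq> top"
      thus "summable (\<lambda>k. relabelled A P k a b)"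
        by (rule summable_suminf_not_top[OF assms])
    qed
    thus ?thesis by (simp add: relabelled_def)
  qed
  show ?thesis
    unfolding infinite_flow_edges_def flow by (auto simp: doubleton_eq_iff)
qed

section \<open>Convergence up to permutation and the infinite flow graph\<close>

theorem theorem8:
  fixes A P :: "nat \<Rightarrow> real ^ 'n ^ 'n"
  assumes "\<And>k. doubly_stochastic (A k)"
    and "permutation_component A P"
  shows "(\<exists>Q :: nat \<Rightarrow> real ^ 'n ^ 'n. (\<forall>k. permutation_matrix (Q k)) \<and>
            (\<forall>t0. convergent (\<lambda>k. Q k ** chain_prod A k t0))) \<and>
         (\<forall>i j. (\<forall>t0. (\<lambda>k. norm (row (trajectory P i k) (chain_prod A k t0)
                                   - row (trajectory P j k) (chain_prod A k t0)))
                       \<longlonglongrightarrow> 0)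
            \<longleftrightarrow> same_connected_component (infinite_flow_graph A P) i j)"
proof -
  have perm: "\<And>k. permutation_matrix (P k)"
    using assms(2) by (simp add: permutation_component_def)
  obtain \<gamma> where "positive_diagonal_chain (relabelled A P) \<gamma>"
    using relabelled_positive_diagonal_chain[OF assms] by blast
  then interpret B: positive_diagonal_chain "relabelled A P" \<gamma> .
  define y where "y s x k i = (chain_prod A k s *v x) $ trajectory P i k" for s x k i
  have avg: "averaging (\<lambda>k. relabelled A P (k + s)) (\<lambda>k i. y s x (k + s) i)" for s x
    unfolding y_def by (rule relabelled_averaging) (rule perm)
  have entry: "chain_prod A k s $ trajectory P i k $ l = y s (axis l 1) k i" for s k i l
    by (simp add: y_def matrix_vector_mult_def axis_def mult_delta_right)
  have row_diff: "y s x k i - y s x k j =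
      (row (trajectory P i k) (chain_prod A k s) - row (trajectory P j k) (chain_prod A k s)) \<bullet> x"
    for s x k i j
    by (simp add: y_def matrix_vector_mult_def row_def inner_vec_def algebra_simps sum_subtractf)
  define E where "E = {(u, v). {u, v} \<in> infinite_flow_edges A P}"

  have conv: "convergent (\<lambda>k. y s x k i)" for s x i
  proof -
    obtain L where "(\<lambda>k. y s x (k + s) i) \<longlonglongrightarrow> L"
      using positive_diagonal_chain.averaging_converges[OF B.shifted_chain avg, of s x i]
      by (auto simp: convergent_def)
    thus ?thesis by (rule convergentI[OF LIMSEQ_offset])
  qed
  define Q where "Q k = (\<chi> i j. if j = trajectory P i k then 1 else (0 :: real))" for k
  have "permutation_matrix (Q k)" for k
    unfolding Q_def by (rule permutation_matrix_of_bij[OF bij_trajectory[of P, OF perm]])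
  moreover have "convergent (\<lambda>k. Q k ** chain_prod A k s)" for s
  proof -
    define L where "L i l = lim (\<lambda>k. y s (axis l 1) k i)" for i l
    have L: "(\<lambda>k. y s (axis l 1) k i) \<longlonglongrightarrow> L i l" for i l
      unfolding L_def by (rule iffD1[OF convergent_LIMSEQ_iff conv])
    have "(\<lambda>k. Q k ** chain_prod A k s) \<longlonglongrightarrow> (\<chi> i l. L i l)"
      by (intro vec_tendstoI) (simp add: Q_def row_selection entry L)
    thus ?thesis by (rule convergentI)
  qed
  moreover have "(\<lambda>k. norm (row (trajectory P i k) (chain_prod A k s)
      - row (trajectory P j k) (chain_prod A k s))) \<longlonglongrightarrow> 0" if "(i, j) \<in> E\<^sup>*" for i j s
  proof -
    have edge: "(\<lambda>k. y s x k u - y s x k v) \<longlonglongrightarrow> 0" if "(u, v) \<in> E" for u v x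
    proof -
      have flow: "(\<lambda>k. y s x k a - y s x k b) \<longlonglongrightarrow> 0"
        if "\<not> summable (\<lambda>k. relabelled A P k a b)" for a b
      proof (rule LIMSEQ_offset)
        show "(\<lambda>k. y s x (k + s) a - y s x (k + s) b) \<longlonglongrightarrow> 0"
          using that
          by (intro positive_diagonal_chain.infinite_flow_imp_equal_limits[OF B.shifted_chain avg])
            (simp add: summable_iff_shift[of "\<lambda>k. relabelled A P k a b"])
      qed
      have "\<not> summable (\<lambda>k. relabelled A P k u v) \<or> \<not> summable (\<lambda>k. relabelled A P k v u)"
        using \<open>(u, v) \<in> E\<close> by (simp add: E_def infinite_flow_edge_iff B.nonneg)
      thus ?thesis
        using flow[of u v] tendsto_minus[OF flow[of v u]] by auto
    qed
    have "(\<lambda>k. y s x k i - y s x k j) \<longlonglongrightarrow> 0" for x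
      using \<open>(i, j) \<in> E\<^sup>*\<close>
    proof induction
      case (step u v)
      from tendsto_add[OF step.IH edge[OF step.hyps(2), of x]] show ?case by simp
    qed simp
    hence "(\<lambda>k. row (trajectory P i k) (chain_prod A k s)
        - row (trajectory P j k) (chain_prod A k s)) \<longlonglongrightarrow> 0"
      by (intro vec_tendstoI) (simp add: row_def entry)
    thus ?thesis by (rule tendsto_norm_zero)
  qed
  moreover have "(i, j) \<in> E\<^sup>*"
    if rows: "\<And>s. (\<lambda>k. norm (row (trajectory P i k) (chain_prod A k s)
      - row (trajectory P j k) (chain_prod A k s))) \<longlonglongrightarrow> 0" for i j
  proof (rule ccontr)
    assume "(i, j) \<notin> E\<^sup>*"
    define S where "S = E\<^sup>* `` {i}"
    have ij: "i \<in> S" "j \<notin> S" using \<open>(i, j) \<notin> E\<^sup>*\<close> by (auto simp: S_def)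
    have no_edge: "{a, b} \<notin> infinite_flow_edges A P" if "a \<in> S" "b \<notin> S" for a b
      using that by (auto simp: S_def E_def dest: rtrancl_into_rtrancl)
    have "summable (\<lambda>k. relabelled A P k a b)" if "a \<in> S \<longleftrightarrow> b \<notin> S" for a b
      using that no_edge[of a b] no_edge[of b a]
      by (auto simp: infinite_flow_edge_iff B.nonneg)
    hence out: "summable (\<lambda>k. B.outflow S k + B.outflow (- S) k)"
      unfolding B.outflow_def by (intro summable_add summable_sum) auto
    from suminf_exist_split[OF _ this, of "1/2"] obtain s where
      tail: "norm (\<Sum>t. B.outflow S (t + s) + B.outflow (- S) (t + s)) < 1/2"
      by force
    interpret Bs: positive_diagonal_chain "\<lambda>k. relabelled A P (k + s)" \<gamma>
      by (rule B.shifted_chain)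
    have out_shift: "Bs.outflow T t = B.outflow T (t + s)" for T t
      by (simp add: Bs.outflow_def B.outflow_def)
    \<comment> \<open>At time \<open>s\<close> the observers of \<open>S\<close> sit at their trajectory positions, not at their labels.\<close>
    define x where "x = (\<chi> l. of_bool (l \<in> (\<lambda>i. trajectory P i s) ` S) :: real ^ 'n)"
    have start: "y s x (0 + s) a = of_bool (a \<in> S)" for a
      using bij_is_inj[OF bij_trajectory[of P s, OF perm]]
      by (auto simp: y_def x_def chain_prod_start dest: injD)
    have sep: "1/2 \<le> y s x (k + s) i - y s x (k + s) j" for k
    proof -
      have "(\<Sum>t<k. B.outflow S (t + s) + B.outflow (- S) (t + s))
          \<le> (\<Sum>t. B.outflow S (t + s) + B.outflow (- S) (t + s))"
        using summable_ignore_initial_segment[OF out, of s]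
        by (intro sum_le_suminf) (auto simp: B.outflow_nonneg)
      also have "\<dots> \<le> 1/2" using tail by simp
      finally show ?thesis
        using Bs.indicator_separation[OF avg start ij, of k] by (simp add: out_shift)
    qed
    have "(\<lambda>k. y s x k i - y s x k j) \<longlonglongrightarrow> 0"
      using tendsto_inner[OF tendsto_norm_zero_cancel[OF rows[of s]] tendsto_const[of x]]
      by (simp add: row_diff)
    from LIMSEQ_ignore_initial_segment[OF this, of s] sep show False
      using LIMSEQ_le_const[of _ 0 "1/2"] by fastforce
  qed
  ultimately show ?thesis
    unfolding same_connected_component_iff E_def by blast
qed

end
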